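(* For all integers $n, d$ with $1 \le d < n$, $$\mathrm{off}(n,d) = \frac{1}{n\,\mathcal{SL}(n,n-d) - 1}.$$
   Context: For integers $n,d\ge 1$, $\mathrm{off}(n,d)$ denotes the minimum $\epsilon\ge 0$ such that there exists a real $n\times n$ matrix $B$ of rank at most $d$ with $B_{ii}=1$ for all $i$ and $|B_{ij}|\le \epsilon$ for all $i\ne j$ ($B$ is not required to be symmetric or positive semidefinite). For a nonzero probability mass $\mu$ on $\mathbb{R}^k$ define $$\mathcal{L}(\mu)=\inf_{y\in \mathrm{supp}(\mu)\setminus\{0\}}\ \inf_{v\in\mathbb{R}^k\setminus\{0\}} \frac{\mathbb{E}_{x\sim\mu}\big[|\langle v,x\rangle|\big]}{|\langle v,y\rangle|},$$ where a quotient with denominator $0$ is read as $+\infty$. Let $\mathcal{P}(n,k)$ be the collection of all probability masses $\mu$ for which there is a multiset $X$ of $n$ vectors in $\mathbb{R}^k$ that span $\mathbb{R}^k$ and such that $\mu$ is the uniform distribution over $X$ (counted with multiplicity). Then $\mathcal{SL}(n,k)=\sup_{\mu\in\mathcal{P}(n,k)}\mathcal{L}(\mu)$. *)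

theory Defs
  imports "HOL-Probability.Probability" "Jordan_Normal_Form.DL_Rank"
begin

text \<open>
  Since the dimensions \<open>n\<close> and \<open>k = n - d\<close> vary, vectors and matrices are those with explicit
  carriers. The name \<open>vec\<close> and the infix dot are also used by the Euclidean-space library,
  hence the qualified type name and the prefix \<^const>\<open>scalar_prod\<close>.
\<close>

definition off_feasible :: "nat \<Rightarrow> nat \<Rightarrow> real \<Rightarrow> bool" where
  "off_feasible n d \<epsilon> \<longleftrightarrow> \<epsilon> \<ge> 0 \<and>
     (\<exists>B :: real mat. B \<in> carrier_mat n n \<and> vec_space.rank n B \<le> d \<and>
        (\<forall>i<n. B $$ (i, i) = 1) \<and>
        (\<forall>i<n. \<forall>j<n. i \<noteq> j \<longrightarrow> \<bar>B $$ (i, j)\<bar> \<le> \<epsilon>))"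

text \<open>A minimum, not merely an infimum: the value is unspecified unless it is attained.\<close>

definition off :: "nat \<Rightarrow> nat \<Rightarrow> real" where
  "off n d = (LEAST \<epsilon>. off_feasible n d \<epsilon>)"

text \<open>
  The zero denominator is treated separately because \<^typ>\<open>ereal\<close> division gives \<open>0 / 0 = 0\<close>.
\<close>

definition ratio :: "real Matrix.vec pmf \<Rightarrow> real Matrix.vec \<Rightarrow> real Matrix.vec \<Rightarrow> ereal" where
  "ratio \<mu> y v =
     (if scalar_prod v y = 0 then \<infinity>
      else ereal (measure_pmf.expectation \<mu> (\<lambda>x. \<bar>scalar_prod v x\<bar>) / \<bar>scalar_prod v y\<bar>))"

text \<open>
  Meant for distributions on \<open>carrier_vec k\<close>. The expectation is a Bochner integral, which is
  the true expectation for the finitely supported distributions used below.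
\<close>

definition L :: "nat \<Rightarrow> real Matrix.vec pmf \<Rightarrow> ereal" where
  "L k \<mu> = (INF y \<in> set_pmf \<mu> - {0\<^sub>v k}. INF v \<in> carrier_vec k - {0\<^sub>v k}. ratio \<mu> y v)"

definition P :: "nat \<Rightarrow> nat \<Rightarrow> real Matrix.vec pmf set" where
  "P n k = {\<mu>. \<exists>X :: real Matrix.vec multiset.
      size X = n \<and> set_mset X \<subseteq> carrier_vec k \<and>
      LinearCombinations.module.span class_ring (module_vec TYPE(real) k) (set_mset X)
        = carrier_vec k \<and>
      \<mu> = pmf_of_multiset X}"

definition SL :: "nat \<Rightarrow> nat \<Rightarrow> ereal" where
  "SL n k = (SUP \<mu> \<in> P n k. L k \<mu>)"

end

theory Submission
  imports Defs "Jordan_Normal_Form.Matrix_Kernel"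
begin

text \<open>
  Put \<open>k = n - d\<close>. A multiset of \<open>n\<close> vectors spanning \<open>\<real>\<^sup>k\<close> is the family of columns of a
  \<open>k \<times> n\<close> matrix \<open>A\<close> with independent rows, and the vectors \<open>w = (v \<bullet> x\<^sub>j)\<^sub>j\<close> run through the
  \<open>k\<close>-dimensional row space \<open>W\<close> of \<open>A\<close>. For the uniform distribution \<open>\<mu>\<close> on the columns,
  \<open>n * L k \<mu> - 1\<close> is at least \<open>t\<close> iff \<open>t * \<bar>w\<^sub>i\<bar> \<le> (\<Sum>j \<noteq> i. \<bar>w\<^sub>j\<bar>)\<close> for all \<open>w \<in> W\<close> and all \<open>i\<close>
  (lemma \<open>le_L_iff\<close>).

  If \<open>B\<close> has unit diagonal, other entries bounded by \<open>\<epsilon>\<close>, and rank at most \<open>d\<close>, then \<open>A * B = 0\<close>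
  for some such \<open>A\<close>. Every \<open>w \<in> W\<close> satisfies \<open>w\<^sub>i = - (\<Sum>j \<noteq> i. w\<^sub>j * B\<^sub>j\<^sub>i)\<close>, which gives the
  inequality with \<open>t = 1 / \<epsilon>\<close> (lemma \<open>off_feasible_imp_le_L\<close>). Conversely, if the inequality holds
  for \<open>t > 0\<close>, then by finite-dimensional Hahn-Banach duality (lemma \<open>zonotope_membership\<close>) the
  functional \<open>w \<mapsto> w\<^sub>i\<close> on \<open>W\<close> is a combination of the other coordinates with coefficients of
  absolute value at most \<open>1 / t\<close>. These coefficients, negated, are the off-diagonal entries of
  column \<open>i\<close> of a matrix \<open>B\<close> with \<open>A * B = 0\<close>, hence of rank at most \<open>d\<close>
  (lemma \<open>le_L_imp_off_feasible\<close>).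

  So the feasible values \<open>\<epsilon>\<close> and the lower bounds \<open>t\<close> correspond through \<open>t = 1 / \<epsilon>\<close>. The
  minimum \<open>off n d\<close> is attained because matrices of bounded rank form a closed set
  (lemma \<open>off_attained\<close>), and it is positive because \<open>d < n\<close>.
\<close>

unbundle no vec_syntax
unbundle no inner_syntax
hide_const (open) Finite_Cartesian_Product.vec Finite_Cartesian_Product.mat Determinants.det
  Cartesian_Space.rank

section \<open>Rank and annihilating matrices\<close>

lemma mult_mat_vec_zero: "A \<in> carrier_mat n m \<Longrightarrow> A *\<^sub>v 0\<^sub>v m = 0\<^sub>v n"
  by (intro eq_vecI) auto

text \<open>
  Injectivity of the linear map of \<open>M\<close>, that is, linear independence of its columns as a family.
  Unlike the linear independence of the set of columns, it excludes repeated columns.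
\<close>

definition trivial_kernel :: "'a :: field mat \<Rightarrow> bool" where
  "trivial_kernel M \<longleftrightarrow>
     (\<forall>v \<in> carrier_vec (dim_col M). M *\<^sub>v v = 0\<^sub>v (dim_row M) \<longrightarrow> v = 0\<^sub>v (dim_col M))"

lemma trivial_kernelI:
  assumes "M \<in> carrier_mat n m"
    and "\<And>v. v \<in> carrier_vec m \<Longrightarrow> M *\<^sub>v v = 0\<^sub>v n \<Longrightarrow> v = 0\<^sub>v m"
  shows "trivial_kernel M"
  using assms unfolding trivial_kernel_def by auto

lemma trivial_kernelD:
  assumes "trivial_kernel M" "M \<in> carrier_mat n m" "v \<in> carrier_vec m" "M *\<^sub>v v = 0\<^sub>v n"
  shows "v = 0\<^sub>v m"
  using assms unfolding trivial_kernel_def by auto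

lemma trivial_kernel_imp_distinct_cols:
  fixes M :: "'a :: field mat"
  assumes M: "M \<in> carrier_mat n m" and tk: "trivial_kernel M"
  shows "distinct (cols M)"
proof (rule ccontr)
  assume "\<not> distinct (cols M)"
  then obtain i j where ij: "i < m" "j < m" "i \<noteq> j" "col M i = col M j"
    using M by (auto simp: distinct_conv_nth)
  have unit: "M *\<^sub>v unit_vec m l = col M l" if "l < m" for l
    using M that by (intro eq_vecI) auto
  have "M *\<^sub>v (unit_vec m i - unit_vec m j) = M *\<^sub>v unit_vec m i - M *\<^sub>v unit_vec m j"
    by (rule mult_minus_distrib_mat_vec[OF M]) auto
  also have "\<dots> = col M i - col M j"
    using unit[OF ij(1)] unit[OF ij(2)] by simp
  also have "\<dots> = 0\<^sub>v n" using M ij by auto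
  finally have "unit_vec m i - unit_vec m j = (0\<^sub>v m :: 'a Matrix.vec)"
    by (intro trivial_kernelD[OF tk M]) auto
  then have "(unit_vec m i - unit_vec m j) $ i = (0\<^sub>v m :: 'a Matrix.vec) $ i" by simp
  then show False using ij by simp
qed

lemma trivial_kernel_imp_indpt_cols:
  fixes M :: "'a :: field mat"
  assumes M: "M \<in> carrier_mat n m" and tk: "trivial_kernel M"
  shows "LinearCombinations.module.lin_indpt class_ring (module_vec TYPE('a) n) (set (cols M))"
proof -
  interpret vec_space "TYPE('a)" n .
  show ?thesis
    using lin_depE[OF M _ trivial_kernel_imp_distinct_cols[OF M tk]] trivial_kernelD[OF tk M]
    by metis
qed

lemma trivial_kernel_mat_of_cols:
  fixes us :: "'a :: field Matrix.vec list"
  assumes "set us \<subseteq> carrier_vec n" "distinct us"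
    and "LinearCombinations.module.lin_indpt class_ring (module_vec TYPE('a) n) (set us)"
  shows "trivial_kernel (mat_of_cols n us)"
proof -
  interpret vec_space "TYPE('a)" n .
  have c: "cols (mat_of_cols n us) = us" using assms(1) by (simp add: subset_iff)
  show ?thesis
    using lin_depI[of "mat_of_cols n us" "length us"] assms(2,3) unfolding c
    by (intro trivial_kernelI[of _ n "length us"]) auto
qed

lemma trivial_kernel_dim_le:
  fixes M :: "'a :: field mat"
  assumes M: "M \<in> carrier_mat n m" and tk: "trivial_kernel M"
  shows "m \<le> n"
proof -
  interpret vec_space "TYPE('a)" n .
  have "card (set (cols M)) \<le> dim"
    using li_le_dim(2)[OF fin_dim _ trivial_kernel_imp_indpt_cols[OF M tk]] M cols_dim[of M] by auto
  then show ?thesis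
    using distinct_card[OF trivial_kernel_imp_distinct_cols[OF M tk]] M dim_is_n by simp
qed

lemma (in vec_space) exists_maximal_indpt_cols:
  assumes B: "B \<in> carrier_mat n nc"
  obtains U where "maximal U (\<lambda>T. T \<subseteq> set (cols B) \<and> lin_indpt T)" "card U = rank B"
proof -
  obtain U where U: "maximal U (\<lambda>T. T \<subseteq> set (cols B) \<and> lin_indpt T)"
    using maximal_exists[of "(\<lambda>T. T \<subseteq> set (cols B) \<and> lin_indpt T)" "card (set (cols B))" "{}"]
    by (meson List.finite_set card_mono empty_iff empty_subsetI finite_lin_indpt2 rev_finite_subset)
  then show thesis using that rank_card_indpt[OF B U] by simp
qed

text \<open>
  A matrix has rank at least \<open>r\<close> iff some \<open>r\<close> of its columns, selected by \<open>f\<close>, form a matrix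
  with trivial kernel. The index function need not be assumed injective, since a repeated column
  produces a kernel vector.
\<close>

lemma le_rank_iff:
  fixes B :: "'a :: field mat"
  assumes B: "B \<in> carrier_mat n m"
  shows "r \<le> vec_space.rank n B \<longleftrightarrow>
    (\<exists>f. (\<forall>j<r. f j < m) \<and> trivial_kernel (mat n r (\<lambda>(i, j). B $$ (i, f j))))"
proof -
  interpret vec_space "TYPE('a)" n .
  have cB: "set (cols B) \<subseteq> carrier_vec n" using B cols_dim[of B] by auto
  show ?thesis
  proof
    assume le: "r \<le> rank B"
    obtain U where U: "maximal U (\<lambda>T. T \<subseteq> set (cols B) \<and> lin_indpt T)" "card U = rank B"
      using exists_maximal_indpt_cols[OF B] .
    then have "r \<le> card U" using le by simp
    then obtain T where T: "T \<subseteq> U" "card T = r" "finite T"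
      using obtain_subset_with_card_n by metis
    have TU: "T \<subseteq> set (cols B)" "lin_indpt T"
      using U T subset_li_is_li unfolding maximal_def by auto
    obtain us where us: "set us = T" "distinct us" "length us = r"
      using finite_distinct_list[OF T(3)] T(2) distinct_card by metis
    have "\<forall>j<r. \<exists>i<m. col B i = us ! j"
      using TU(1) us B
      by (metis carrier_matD(2) cols_length cols_nth in_set_conv_nth nth_mem subsetD)
    then obtain f where f: "\<forall>j<r. f j < m \<and> col B (f j) = us ! j" by metis
    have "mat n r (\<lambda>(i, j). B $$ (i, f j)) = mat_of_cols n us"
    proof (rule eq_matI)
      fix i j assume "i < dim_row (mat_of_cols n us)" "j < dim_col (mat_of_cols n us)"
      then have ij: "i < n" "j < r" using us by auto
      then show "mat n r (\<lambda>(i, j). B $$ (i, f j)) $$ (i, j) = mat_of_cols n us $$ (i, j)"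
        using f[rule_format, OF ij(2)] B us
        by (auto simp: mat_of_cols_index dest: arg_cong[where f = "\<lambda>v. v $ i"])
    qed (use us in auto)
    moreover have "trivial_kernel (mat_of_cols n us)"
      using trivial_kernel_mat_of_cols[of us n] us TU cB by auto
    ultimately show "\<exists>f. (\<forall>j<r. f j < m) \<and> trivial_kernel (mat n r (\<lambda>(i, j). B $$ (i, f j)))"
      using f by metis
  next
    assume "\<exists>f. (\<forall>j<r. f j < m) \<and> trivial_kernel (mat n r (\<lambda>(i, j). B $$ (i, f j)))"
    then obtain f where f: "\<forall>j<r. f j < m"
      and tk: "trivial_kernel (mat n r (\<lambda>(i, j). B $$ (i, f j)))" (is "trivial_kernel ?M") by blast
    have M: "?M \<in> carrier_mat n r" by simp
    have "col ?M j = col B (f j)" if "j < r" for j using that f B by (auto intro!: eq_vecI)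
    then have "set (cols ?M) \<subseteq> set (cols B)"
      using f B by (auto simp: cols_def)
    then have "card (set (cols ?M)) \<le> rank B"
      using rank_ge_card_indpt[OF B] trivial_kernel_imp_indpt_cols[OF M tk] by blast
    then show "r \<le> rank B"
      using distinct_card[OF trivial_kernel_imp_distinct_cols[OF M tk]] by simp
  qed
qed

text \<open>
  A weak form of rank-nullity: \<open>r\<close> homogeneous equations in \<open>n\<close> unknowns have \<open>k\<close> independent
  solutions for every \<open>k \<le> n - r\<close>, collected here as the columns of \<open>N\<close>.
\<close>

lemma exists_kernel_mat:
  fixes C :: "'a :: field mat"
  assumes C: "C \<in> carrier_mat r n" and k: "k + r \<le> n"
  obtains N where "N \<in> carrier_mat n k" "trivial_kernel N" "C * N = 0\<^sub>m r k"
proof -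
  let ?E = "gauss_jordan_single C"
  note gj = gauss_jordan_single[OF C refl]
  interpret E: kernel r n ?E by unfold_locales (rule gj(2))
  let ?S = "set (find_base_vectors ?E)"
  note fb = find_base_vectors[OF gj(3) gj(2)]
  have "card {i. i < r \<and> row ?E i \<noteq> 0\<^sub>v n} \<le> card {..<r}" by (intro card_mono) auto
  then have "k \<le> card ?S" using fb(4) k by simp
  then obtain T where T: "T \<subseteq> ?S" "card T = k" "finite T"
    using obtain_subset_with_card_n by metis
  obtain us where us: "set us = T" "distinct us" "length us = k"
    using finite_distinct_list[OF T(3)] T(2) distinct_card by metis
  have ker: "C *\<^sub>v v = 0\<^sub>v r" "v \<in> carrier_vec n" if "v \<in> T" for v
    using that T(1) fb(1) mat_kernelD[OF gj(2)] gj(1) by auto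
  have "E.NC.lin_indpt ?S"
    using fb(3) E.lindep_same[OF fb(1)] unfolding E.Ker.basis_def by blast
  then have "E.NC.lin_indpt T" using T(1) E.NC.subset_li_is_li by blast
  then have tk: "trivial_kernel (mat_of_cols n us)"
    using us ker(2) by (intro trivial_kernel_mat_of_cols) auto
  have "C * mat_of_cols n us = 0\<^sub>m r k"
  proof (rule eq_matI)
    fix i j assume "i < dim_row (0\<^sub>m r k :: 'a mat)" "j < dim_col (0\<^sub>m r k :: 'a mat)"
    then have ij: "i < r" "j < k" by auto
    then have "us ! j \<in> T" using us by auto
    then have "(C *\<^sub>v (us ! j)) $ i = 0" "us ! j \<in> carrier_vec n" using ker ij by auto
    then show "(C * mat_of_cols n us) $$ (i, j) = 0\<^sub>m r k $$ (i, j)"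
      using C ij us by simp
  qed (use C us in auto)
  then show thesis using that[of "mat_of_cols n us"] tk us(3) by auto
qed

lemma span_subset_mat_kernel:
  fixes C :: "'a :: field mat"
  assumes C: "C \<in> carrier_mat r n" and S: "S \<subseteq> mat_kernel C"
  shows "LinearCombinations.module.span class_ring (module_vec TYPE('a) n) S \<subseteq> mat_kernel C"
proof -
  interpret kernel r n C by unfold_locales (rule C)
  show ?thesis using span_same[OF S] Ker.span_is_subset2[OF S] by simp
qed

text \<open>
  This lemma and \<open>rank_le_if_left_kernel_mat\<close> below show that a real matrix \<open>B\<close> has rank
  at most \<open>n - k\<close>, where \<open>k \<le> n\<close>, iff it is annihilated from the left by a \<open>k \<times> n\<close> matrix of rank \<open>k\<close>.
\<close>

lemma left_kernel_mat:
  fixes B :: "'a :: field mat"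
  assumes B: "B \<in> carrier_mat n m" and rk: "k + vec_space.rank n B \<le> n"
  obtains A where "A \<in> carrier_mat k n" "trivial_kernel (transpose_mat A)" "A * B = 0\<^sub>m k m"
proof -
  interpret vec_space "TYPE('a)" n .
  have cB: "set (cols B) \<subseteq> carrier_vec n" using B cols_dim[of B] by auto
  obtain U where U: "maximal U (\<lambda>T. T \<subseteq> set (cols B) \<and> lin_indpt T)"
    and cU: "card U = rank B"
    using exists_maximal_indpt_cols[OF B] .
  have UB: "U \<subseteq> set (cols B)" "lin_indpt U" using U unfolding maximal_def by auto
  then have fU: "finite U" using finite_subset by blast
  obtain us where us: "set us = U" "distinct us" "length us = card U"
    using finite_distinct_list[OF fU] distinct_card by metis
  have uc: "set us \<subseteq> carrier_vec n" using us UB cB by auto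
  have span: "c \<in> span U" if c: "c \<in> set (cols B)" for c
  proof (rule ccontr)
    assume ns: "c \<notin> span U"
    have Uc: "U \<subseteq> carrier_vec n" "c \<in> carrier_vec n" using UB cB c by auto
    then have "c \<notin> U" using ns span_mem by auto
    then have "lin_indpt (U \<union> {c})" using ns lin_dep_iff_in_span[OF Uc(1) UB(2) Uc(2)] by blast
    then have "U \<union> {c} = U" using U c unfolding maximal_def by blast
    then show False using \<open>c \<notin> U\<close> by blast
  qed
  \<comment> \<open>Vectors orthogonal to \<open>U\<close> are orthogonal to all columns of \<open>B\<close>, and there are \<open>k\<close>
    independent ones.\<close>
  let ?C = "mat_of_rows n us"
  have C: "?C \<in> carrier_mat (card U) n" using us by auto
  obtain N where N: "N \<in> carrier_mat n k" "trivial_kernel N" "?C * N = 0\<^sub>m (card U) k"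
    using exists_kernel_mat[OF C] rk cU by auto
  let ?A = "transpose_mat N"
  have A: "?A \<in> carrier_mat k n" using N by simp
  have ker: "U \<subseteq> mat_kernel ?A"
  proof
    fix u assume "u \<in> U"
    then obtain i where i: "i < card U" "u = us ! i" using us by (metis in_set_conv_nth)
    have u: "u \<in> carrier_vec n" using \<open>u \<in> U\<close> us uc by auto
    have "?A *\<^sub>v u = 0\<^sub>v k"
    proof (rule eq_vecI)
      fix j assume "j < dim_vec (0\<^sub>v k :: 'a Matrix.vec)"
      then have j: "j < k" by simp
      have "(?C * N) $$ (i, j) = 0" using N(3) i j by simp
      moreover have "row ?C i = u" using i us(3) u by simp
      ultimately have "u \<bullet> col N j = 0"
        using index_mult_mat(1)[of i ?C j N] i j N C by auto
      then show "(?A *\<^sub>v u) $ j = 0\<^sub>v k $ j"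
        using j N comm_scalar_prod[OF u, of "col N j"] by simp
    qed (use N in auto)
    then show "u \<in> mat_kernel ?A" using mat_kernelI[OF A u] by simp
  qed
  have colB: "?A *\<^sub>v col B j = 0\<^sub>v k" if "j < m" for j
  proof -
    have "col B j \<in> set (cols B)" using that B by (auto simp: cols_def)
    then have "col B j \<in> mat_kernel ?A" using span span_subset_mat_kernel[OF A ker] by blast
    then show ?thesis using mat_kernelD[OF A] by blast
  qed
  have "?A * B = 0\<^sub>m k m"
  proof (rule eq_matI)
    fix i j assume "i < dim_row (0\<^sub>m k m :: 'a mat)" "j < dim_col (0\<^sub>m k m :: 'a mat)"
    then have "i < k" "j < m" by auto
    then show "(?A * B) $$ (i, j) = 0\<^sub>m k m $$ (i, j)"
      using colB[of j] A B by (auto dest!: arg_cong[where f = "\<lambda>v. v $ i"])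
  qed (use A B in auto)
  then show thesis using that[of ?A] A N by simp
qed

lemma real_trivial_kernel_iff_det_gram:
  fixes M :: "real mat"
  assumes M: "M \<in> carrier_mat n r"
  shows "trivial_kernel M \<longleftrightarrow> det (transpose_mat M * M) \<noteq> 0"
proof -
  have T: "transpose_mat M \<in> carrier_mat r n" using M by simp
  have G: "transpose_mat M * M \<in> carrier_mat r r" using M by simp
  have "(transpose_mat M * M) *\<^sub>v v = 0\<^sub>v r \<longleftrightarrow> M *\<^sub>v v = 0\<^sub>v n" if v: "v \<in> carrier_vec r" for v
  proof
    have Mv: "M *\<^sub>v v \<in> carrier_vec n" using M v by simp
    have asm: "(transpose_mat M * M) *\<^sub>v v = transpose_mat M *\<^sub>v (M *\<^sub>v v)"
      by (rule assoc_mult_mat_vec[OF T M v])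
    assume "(transpose_mat M * M) *\<^sub>v v = 0\<^sub>v r"
    then have "(transpose_mat M *\<^sub>v (M *\<^sub>v v)) \<bullet> v = 0" using asm v by simp
    then have "(M *\<^sub>v v) \<bullet> (M *\<^sub>v v) = 0" using transpose_vec_mult_scalar[OF M v Mv] by simp
    then show "M *\<^sub>v v = 0\<^sub>v n" using conjugate_square_eq_0_vec[OF Mv] by simp
  next
    assume "M *\<^sub>v v = 0\<^sub>v n"
    then show "(transpose_mat M * M) *\<^sub>v v = 0\<^sub>v r" using assoc_mult_mat_vec[OF T M v] mult_mat_vec_zero[OF T] by simp
  qed
  then show ?thesis
    using det_0_iff_vec_prod_zero_field[OF G] M unfolding trivial_kernel_def by auto
qed

text \<open>
  The \<open>k\<close> independent rows of \<open>A\<close> are orthogonal to the columns of \<open>B\<close>; together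
  with a maximal independent family of columns of \<open>B\<close> they are still independent.
\<close>

lemma rank_le_if_left_kernel_mat:
  fixes A B :: "real mat"
  assumes A: "A \<in> carrier_mat k n" and tk: "trivial_kernel (transpose_mat A)"
    and B: "B \<in> carrier_mat n m" and AB: "A * B = 0\<^sub>m k m"
  shows "k + vec_space.rank n B \<le> n"
proof -
  let ?r = "vec_space.rank n B"
  obtain f where f: "\<forall>j<?r. f j < m"
    and tkM: "trivial_kernel (mat n ?r (\<lambda>(i, j). B $$ (i, f j)))" (is "trivial_kernel ?M")
    using le_rank_iff[OF B, of ?r] by auto
  have M: "?M \<in> carrier_mat n ?r" by simp
  have T: "transpose_mat A \<in> carrier_mat n k" using A by simp
  have AM: "A * ?M = 0\<^sub>m k ?r"
  proof (rule eq_matI)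
    fix i j assume "i < dim_row (0\<^sub>m k ?r :: real mat)" "j < dim_col (0\<^sub>m k ?r :: real mat)"
    then have ij: "i < k" "j < ?r" by auto
    have "(A * B) $$ (i, f j) = 0" using AB ij f by simp
    moreover have "col ?M j = col B (f j)" using ij f B by (auto intro!: eq_vecI)
    ultimately show "(A * ?M) $$ (i, j) = 0\<^sub>m k ?r $$ (i, j)" using ij f A B by simp
  qed (use A in auto)
  let ?N = "mat n (k + ?r) (\<lambda>(i, j). if j < k then A $$ (j, i) else ?M $$ (i, j - k))"
  have N: "?N \<in> carrier_mat n (k + ?r)" by simp
  have "trivial_kernel ?N"
  proof (rule trivial_kernelI[OF N])
    fix w :: "real Matrix.vec" assume w: "w \<in> carrier_vec (k + ?r)" and Nw: "?N *\<^sub>v w = 0\<^sub>v n"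
    let ?v = "vec_first w k" and ?u = "vec_last w ?r"
    have vu: "?v \<in> carrier_vec k" "?u \<in> carrier_vec ?r" by auto
    have "?N *\<^sub>v w = transpose_mat A *\<^sub>v ?v + ?M *\<^sub>v ?u"
    proof (rule eq_vecI)
      fix i assume "i < dim_vec (transpose_mat A *\<^sub>v ?v + ?M *\<^sub>v ?u)"
      then have i: "i < n" by simp
      have "(?N *\<^sub>v w) $ i = (\<Sum>j = 0..<k + ?r. ?N $$ (i, j) * w $ j)"
        using i w by (simp add: scalar_prod_def)
      also have "\<dots> = (\<Sum>j = 0..<k. ?N $$ (i, j) * w $ j) + (\<Sum>j = k..<k + ?r. ?N $$ (i, j) * w $ j)"
        by (simp add: sum.atLeastLessThan_concat)
      also have "(\<Sum>j = k..<k + ?r. ?N $$ (i, j) * w $ j) = (\<Sum>j = 0..<?r. ?N $$ (i, j + k) * w $ (j + k))"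
        using sum.shift_bounds_nat_ivl[of "\<lambda>j. ?N $$ (i, j) * w $ j" 0 k ?r] by (simp add: add.commute)
      also have "\<dots> = (?M *\<^sub>v ?u) $ i"
        using i w by (auto simp: scalar_prod_def vec_last_def add.commute intro!: sum.cong)
      also have "(\<Sum>j = 0..<k. ?N $$ (i, j) * w $ j) = (transpose_mat A *\<^sub>v ?v) $ i"
        using i A by (auto simp: scalar_prod_def vec_first_def intro!: sum.cong)
      finally show "(?N *\<^sub>v w) $ i = (transpose_mat A *\<^sub>v ?v + ?M *\<^sub>v ?u) $ i" using i by simp
    qed auto
    then have eq: "transpose_mat A *\<^sub>v ?v + ?M *\<^sub>v ?u = 0\<^sub>v n" using Nw by simp
    have c: "transpose_mat A *\<^sub>v ?v \<in> carrier_vec n" "?M *\<^sub>v ?u \<in> carrier_vec n"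
      using mult_mat_vec_carrier[OF T vu(1)] mult_mat_vec_carrier[OF M vu(2)] by auto
    have "A *\<^sub>v (?M *\<^sub>v ?u) = 0\<^sub>v k"
      using assoc_mult_mat_vec[OF A M vu(2), symmetric] AM by auto
    then have "A *\<^sub>v (transpose_mat A *\<^sub>v ?v) = 0\<^sub>v k"
      using arg_cong[OF eq, of "\<lambda>x. A *\<^sub>v x"] mult_add_distrib_mat_vec[OF A c] A c by auto
    then have "(transpose_mat (transpose_mat A) * transpose_mat A) *\<^sub>v ?v = 0\<^sub>v k"
      using assoc_mult_mat_vec[OF A T vu(1)] by simp
    moreover have "transpose_mat (transpose_mat A) * transpose_mat A \<in> carrier_mat k k" using A by simp
    ultimately have v0: "?v = 0\<^sub>v k"
      using real_trivial_kernel_iff_det_gram[OF T] tk det_0_iff_vec_prod_zero_field vu(1) by metis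
    then have "?M *\<^sub>v ?u = 0\<^sub>v n" using eq c(2) mult_mat_vec_zero[OF T] by simp
    then have "?u = 0\<^sub>v ?r" using trivial_kernelD[OF tkM M] vu by blast
    then show "w = 0\<^sub>v (k + ?r)" using v0 vec_first_last_append[OF w] by auto
  qed
  then show ?thesis by (rule trivial_kernel_dim_le[OF N])
qed

text \<open>
  The rows of \<open>A\<close> are independent iff its columns span: a vector orthogonal to all columns is
  orthogonal to their span, and conversely \<open>A * transpose_mat A\<close> is invertible.
\<close>

lemma span_cols_eq_carrier_iff:
  fixes A :: "real mat"
  assumes A: "A \<in> carrier_mat k n"
  shows "LinearCombinations.module.span class_ring (module_vec TYPE(real) k) (set (cols A)) = carrier_vec k
    \<longleftrightarrow> trivial_kernel (transpose_mat A)"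
proof -
  interpret vec_space "TYPE(real)" k .
  have T: "transpose_mat A \<in> carrier_mat n k" using A by simp
  have cA: "set (cols A) \<subseteq> carrier_vec k" using A cols_dim[of A] by auto
  show ?thesis
  proof
    assume sp: "span (set (cols A)) = carrier_vec k"
    show "trivial_kernel (transpose_mat A)"
    proof (rule trivial_kernelI[OF T])
      fix v :: "real Matrix.vec" assume v: "v \<in> carrier_vec k" and Av: "transpose_mat A *\<^sub>v v = 0\<^sub>v n"
      let ?R = "mat_of_rows k [v]"
      have R: "?R \<in> carrier_mat 1 k" using mat_of_rows_carrier(1)[of k "[v]"] by simp
      have ker: "c \<in> mat_kernel ?R \<longleftrightarrow> v \<bullet> c = 0" if "c \<in> carrier_vec k" for c
        using that v unfolding mat_kernel[OF R] by (auto simp: vec_eq_iff)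
      have "set (cols A) \<subseteq> mat_kernel ?R"
      proof
        fix c assume c: "c \<in> set (cols A)"
        then obtain j where j: "j < n" "c = col A j" using A by (auto simp: cols_def)
        have "(transpose_mat A *\<^sub>v v) $ j = 0" using Av j by simp
        then have "v \<bullet> c = 0" using j A comm_scalar_prod[OF v, of c] c cA by auto
        then show "c \<in> mat_kernel ?R" using ker c cA by auto
      qed
      then have "v \<in> mat_kernel ?R" using span_subset_mat_kernel[OF R, of "set (cols A)"] sp v by fast
      then have "v \<bullet> v = 0" using ker v by blast
      then show "v = 0\<^sub>v k" using conjugate_square_eq_0_vec[OF v] by simp
    qed
  next
    assume tk: "trivial_kernel (transpose_mat A)"
    let ?G = "A * transpose_mat A"
    have G: "?G \<in> carrier_mat k k" using A by simp
    have "det ?G \<noteq> 0" using real_trivial_kernel_iff_det_gram[OF T] tk by simp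
    then have "?G \<in> Units (ring_mat TYPE(real) k ())" by (rule det_non_zero_imp_unit[OF G])
    then obtain H where H: "H \<in> carrier_mat k k" "?G * H = 1\<^sub>m k"
      unfolding Units_def ring_mat_simps by blast
    have "y \<in> span (set (cols A))" if y: "y \<in> carrier_vec k" for y
    proof -
      let ?z = "transpose_mat A *\<^sub>v (H *\<^sub>v y)"
      have Hy: "H *\<^sub>v y \<in> carrier_vec k" using H y by simp
      have z: "?z \<in> carrier_vec n" using T Hy by simp
      have "A *\<^sub>v ?z = ?G *\<^sub>v (H *\<^sub>v y)" using assoc_mult_mat_vec[OF A T Hy] by simp
      also have "\<dots> = (?G * H) *\<^sub>v y" using assoc_mult_mat_vec[OF G H(1) y] by simp
      also have "\<dots> = y" using H(2) y by simp
      finally have Az: "A *\<^sub>v ?z = y" .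
      have "A = mat_of_cols k (cols A)" using A by auto
      moreover have "lincomb f (set (cols A)) \<in> span (set (cols A))" for f
        unfolding span_def by blast
      then have "mat_of_cols k (cols A) *\<^sub>v ?z \<in> span (set (cols A))"
        using z A by (subst mat_of_cols_mult_as_finsum) auto
      ultimately show ?thesis using Az by simp
    qed
    then show "span (set (cols A)) = carrier_vec k"
      using span_is_subset2[OF cA] by auto
  qed
qed

section \<open>Semicontinuity of the rank and attainment of the minimum\<close>

lemma tendsto_det:
  fixes G :: "nat \<Rightarrow> real mat"
  assumes "\<And>t. G t \<in> carrier_mat r r" "H \<in> carrier_mat r r"
    and "\<And>i j. i < r \<Longrightarrow> j < r \<Longrightarrow> (\<lambda>t. G t $$ (i, j)) \<longlonglongrightarrow> H $$ (i, j)"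
  shows "(\<lambda>t. det (G t)) \<longlonglongrightarrow> det H"
  unfolding det_def'[OF assms(1)] det_def'[OF assms(2)]
  by (intro tendsto_sum tendsto_mult tendsto_const tendsto_prod assms(3))
     (auto dest: permutes_in_image)

text \<open>
  Matrices of rank at most \<open>d\<close> form a closed set: independence of \<open>d + 1\<close> columns means that
  their Gram determinant is nonzero, which is an open condition.
\<close>

lemma rank_le_limit:
  fixes Bs :: "nat \<Rightarrow> real mat"
  assumes Bs: "\<And>t. Bs t \<in> carrier_mat n m" and B: "B \<in> carrier_mat n m"
    and lim: "\<And>i j. i < n \<Longrightarrow> j < m \<Longrightarrow> (\<lambda>t. Bs t $$ (i, j)) \<longlonglongrightarrow> B $$ (i, j)"
    and rk: "\<And>t. vec_space.rank n (Bs t) \<le> d"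
  shows "vec_space.rank n B \<le> d"
proof (rule ccontr)
  assume "\<not> ?thesis"
  then have "Suc d \<le> vec_space.rank n B" by simp
  then obtain f where f: "\<forall>j<Suc d. f j < m"
    and tk: "trivial_kernel (mat n (Suc d) (\<lambda>(i, j). B $$ (i, f j)))"
    using le_rank_iff[OF B] by blast
  define M where "M C = mat n (Suc d) (\<lambda>(i, j). C $$ (i, f j))" for C :: "real mat"
  have M: "M C \<in> carrier_mat n (Suc d)" for C unfolding M_def by simp
  have "(\<lambda>t. det (transpose_mat (M (Bs t)) * M (Bs t))) \<longlonglongrightarrow> det (transpose_mat (M B) * M B)"
  proof (rule tendsto_det)
    fix i j assume ij: "i < Suc d" "j < Suc d"
    have e: "(transpose_mat (M C) * M C) $$ (i, j) = (\<Sum>l = 0..<n. C $$ (l, f i) * C $$ (l, f j))" for C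
      using ij M[of C] by (simp add: M_def scalar_prod_def)
    show "(\<lambda>t. (transpose_mat (M (Bs t)) * M (Bs t)) $$ (i, j))
        \<longlonglongrightarrow> (transpose_mat (M B) * M B) $$ (i, j)"
      unfolding e using ij f by (intro tendsto_sum tendsto_mult lim) auto
  qed (use M in \<open>auto intro!: mult_carrier_mat[of _ _ n]\<close>)
  moreover have "det (transpose_mat (M B) * M B) \<noteq> 0"
    using real_trivial_kernel_iff_det_gram[OF M] tk unfolding M_def by blast
  ultimately have "\<forall>\<^sub>F t in sequentially. det (transpose_mat (M (Bs t)) * M (Bs t)) \<noteq> 0"
    by (rule tendsto_imp_eventually_ne)
  then obtain t where "det (transpose_mat (M (Bs t)) * M (Bs t)) \<noteq> 0"
    by (auto simp: eventually_sequentially)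
  then have "trivial_kernel (M (Bs t))" using real_trivial_kernel_iff_det_gram[OF M] by blast
  then have "Suc d \<le> vec_space.rank n (Bs t)"
    using le_rank_iff[OF Bs] f unfolding M_def by blast
  then show False using rk[of t] by simp
qed

lemma bounded_family_convergent_subseq:
  fixes f :: "nat \<Rightarrow> 'i \<Rightarrow> real"
  assumes "finite I" and bd: "\<And>t i. i \<in> I \<Longrightarrow> \<bar>f t i\<bar> \<le> C"
  shows "\<exists>r :: nat \<Rightarrow> nat. strict_mono r \<and> (\<forall>i\<in>I. convergent (\<lambda>t. f (r t) i))"
  using assms
proof (induction I rule: finite_induct)
  case empty
  then show ?case by (auto intro: exI[of _ id] strict_mono_id)
next
  case (insert i I)
  then obtain r :: "nat \<Rightarrow> nat" where r: "strict_mono r" "\<forall>i\<in>I. convergent (\<lambda>t. f (r t) i)" by auto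
  have "bounded (range (\<lambda>t. f (r t) i))"
    using insert.prems by (auto simp: bounded_iff)
  then obtain l s where s: "strict_mono s" "((\<lambda>t. f (r t) i) \<circ> s) \<longlonglongrightarrow> l"
    using bounded_imp_convergent_subsequence by blast
  have "convergent (\<lambda>t. f ((r \<circ> s) t) j)" if "j \<in> insert i I" for j
  proof (cases "j = i")
    case True
    then show ?thesis using s(2) by (auto simp: convergent_def o_def)
  next
    case False
    then show ?thesis
      using convergent_subseq_convergent[OF _ s(1), of "\<lambda>t. f (r t) j"] that r(2) by (auto simp: o_def)
  qed
  then show ?case using strict_mono_o[OF r(1) s(1)] by blast
qed

text \<open>
  Thus the value \<open>off n d\<close> is a genuine minimum, provided that some \<open>\<epsilon>0\<close> is feasible.
\<close>

lemma off_attained: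
  assumes feas: "off_feasible n d \<epsilon>0"
  shows "off_feasible n d (off n d)" and "off_feasible n d \<epsilon> \<Longrightarrow> off n d \<le> \<epsilon>"
proof -
  define e where "e = Inf {\<epsilon>. off_feasible n d \<epsilon>}"
  have bb: "bdd_below {\<epsilon>. off_feasible n d \<epsilon>}" by (auto simp: bdd_below_def off_feasible_def)
  have e_le: "e \<le> \<epsilon>" if "off_feasible n d \<epsilon>" for \<epsilon>
    unfolding e_def using that bb by (auto intro: cInf_lower)
  have e0: "0 \<le> e" unfolding e_def
  proof (rule cInf_greatest)
    show "0 \<le> \<epsilon>" if "\<epsilon> \<in> {\<epsilon>. off_feasible n d \<epsilon>}" for \<epsilon>
      using that by (simp add: off_feasible_def)
  qed (use feas in blast)
  have "\<exists>\<epsilon>. off_feasible n d \<epsilon> \<and> \<epsilon> < e + inverse (real (Suc t))" for t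
    using cInf_lessD[of "{\<epsilon>. off_feasible n d \<epsilon>}" "e + inverse (real (Suc t))"] feas
    unfolding e_def[symmetric] by auto
  then obtain \<delta> where \<delta>: "\<And>t. off_feasible n d (\<delta> t)" "\<And>t. \<delta> t < e + inverse (real (Suc t))" by metis
  then have "\<forall>t. \<exists>B :: real mat. B \<in> carrier_mat n n \<and> vec_space.rank n B \<le> d \<and>
        (\<forall>i<n. B $$ (i, i) = 1) \<and> (\<forall>i<n. \<forall>j<n. i \<noteq> j \<longrightarrow> \<bar>B $$ (i, j)\<bar> \<le> \<delta> t)"
    unfolding off_feasible_def by blast
  then obtain Bs :: "nat \<Rightarrow> real mat" where Bs: "\<And>t. Bs t \<in> carrier_mat n n"
      "\<And>t. vec_space.rank n (Bs t) \<le> d" "\<And>t i. i < n \<Longrightarrow> Bs t $$ (i, i) = 1"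
      "\<And>t i j. i < n \<Longrightarrow> j < n \<Longrightarrow> i \<noteq> j \<Longrightarrow> \<bar>Bs t $$ (i, j)\<bar> \<le> \<delta> t"
    by metis
  have inv1: "inverse (real (Suc t)) \<le> 1" for t by (simp add: field_simps)
  have bd: "\<bar>Bs t $$ p\<bar> \<le> e + 1" if p: "p \<in> {..<n} \<times> {..<n}" for t p
  proof (cases "fst p = snd p")
    case True
    then show ?thesis using Bs(3)[of "fst p" t] p e0 by (cases p) auto
  next
    case False
    then show ?thesis using Bs(4)[of "fst p" "snd p" t] p \<delta>(2)[of t] inv1[of t] by (cases p) auto
  qed
  have "finite ({..<n} \<times> {..<n})" by simp
  then obtain r :: "nat \<Rightarrow> nat" where r: "strict_mono r"
      "\<forall>p\<in>{..<n} \<times> {..<n}. convergent (\<lambda>t. Bs (r t) $$ p)"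
    using bounded_family_convergent_subseq[of "{..<n} \<times> {..<n}" "\<lambda>t p. Bs t $$ p" "e + 1"] bd by blast
  define B where "B = mat n n (\<lambda>p. lim (\<lambda>t. Bs (r t) $$ p))"
  have B: "B \<in> carrier_mat n n" unfolding B_def by simp
  have lim: "(\<lambda>t. Bs (r t) $$ (i, j)) \<longlonglongrightarrow> B $$ (i, j)" if "i < n" "j < n" for i j
    using r(2) that unfolding B_def by (auto simp: convergent_LIMSEQ_iff)
  have diag: "B $$ (i, i) = 1" if "i < n" for i
    using lim[OF that that] Bs(3)[OF that] LIMSEQ_unique tendsto_const by (metis (no_types, lifting) ext)
  have "(\<lambda>t. e + inverse (real (Suc t))) \<longlonglongrightarrow> e + 0"
    by (intro tendsto_add tendsto_const LIMSEQ_inverse_real_of_nat)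
  then have bdlim: "(\<lambda>t. e + inverse (real (Suc (r t)))) \<longlonglongrightarrow> e"
    using LIMSEQ_subseq_LIMSEQ[OF _ r(1)] by (fastforce simp: o_def)
  have offd: "\<bar>B $$ (i, j)\<bar> \<le> e" if "i < n" "j < n" "i \<noteq> j" for i j
  proof (rule LIMSEQ_le[OF tendsto_rabs[OF lim[OF that(1,2)]] bdlim])
    show "\<exists>N. \<forall>t\<ge>N. \<bar>Bs (r t) $$ (i, j)\<bar> \<le> e + inverse (real (Suc (r t)))"
      using Bs(4)[OF that] \<delta>(2) by (meson less_imp_le order_trans)
  qed
  have "vec_space.rank n B \<le> d"
    using rank_le_limit[of "\<lambda>t. Bs (r t)", OF Bs(1) B lim Bs(2)] by blast
  then have fe: "off_feasible n d e"
    unfolding off_feasible_def using e0 B diag offd by blast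
  have "off n d = e" unfolding off_def using fe e_le by (intro Least_equality) auto
  then show "off_feasible n d (off n d)" "off_feasible n d \<epsilon> \<Longrightarrow> off n d \<le> \<epsilon>"
    using fe e_le by auto
qed

section \<open>Duality\<close>

text \<open>
  A vector \<open>y\<close> whose product with every \<open>v\<close> is at most the support function of the zonotope
  \<open>{\<Sum>j\<in>S. b j \<cdot> x j | \<bar>b j\<bar> \<le> c j}\<close> belongs to this zonotope. Membership is expressed through the
  products with all \<open>v\<close>. The proof removes one generator \<open>u\<close> at a time, as in the
  Hahn-Banach theorem: a coefficient \<open>s\<close> is found such that \<open>y - s \<cdot> u\<close> still satisfies the
  hypothesis for the remaining generators.
\<close>

lemma zonotope_membership:
  fixes x :: "'i \<Rightarrow> real Matrix.vec"
  assumes "finite S" and "\<And>j. j \<in> S \<Longrightarrow> x j \<in> carrier_vec k" and "y \<in> carrier_vec k"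
    and "\<And>j. j \<in> S \<Longrightarrow> 0 \<le> c j"
    and "\<And>v. v \<in> carrier_vec k \<Longrightarrow> v \<bullet> y \<le> (\<Sum>j\<in>S. c j * \<bar>v \<bullet> x j\<bar>)"
  shows "\<exists>b. (\<forall>j\<in>S. \<bar>b j\<bar> \<le> c j) \<and>
    (\<forall>v\<in>carrier_vec k. v \<bullet> y = (\<Sum>j\<in>S. b j * (v \<bullet> x j)))"
  using assms
proof (induction S arbitrary: y rule: finite_induct)
  case empty
  have "v \<bullet> y = 0" if v: "v \<in> carrier_vec k" for v
    using empty.prems(4)[of v] empty.prems(4)[of "- v"] v empty.prems(2) by simp
  then show ?case by simp
next
  case (insert i S)
  define u where "u = x i"
  define p where "p v = (\<Sum>j\<in>S. c j * \<bar>v \<bullet> x j\<bar>)" for v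
  have u: "u \<in> carrier_vec k" using insert.prems(1) unfolding u_def by simp
  note y = insert.prems(2)
  have ci: "0 \<le> c i" using insert.prems(3) by simp
  have dom: "v \<bullet> y \<le> p v + c i * \<bar>v \<bullet> u\<bar>" if "v \<in> carrier_vec k" for v
    using insert.prems(4)[OF that] insert.hyps unfolding p_def u_def by simp
  have p_add: "p (v + w) \<le> p v + p w" if "v \<in> carrier_vec k" "w \<in> carrier_vec k" for v w
    unfolding p_def sum.distrib[symmetric]
  proof (rule sum_mono)
    fix j assume j: "j \<in> S"
    then have xj: "x j \<in> carrier_vec k" and cj: "0 \<le> c j" using insert.prems(1,3) by auto
    have "(v + w) \<bullet> x j = v \<bullet> x j + w \<bullet> x j" using that xj by (rule add_scalar_prod_distrib)
    then have "\<bar>(v + w) \<bullet> x j\<bar> \<le> \<bar>v \<bullet> x j\<bar> + \<bar>w \<bullet> x j\<bar>" by simp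
    from mult_left_mono[OF this cj]
    show "c j * \<bar>(v + w) \<bullet> x j\<bar> \<le> c j * \<bar>v \<bullet> x j\<bar> + c j * \<bar>w \<bullet> x j\<bar>" by (simp add: distrib_left)
  qed
  have p_scale: "p (a \<cdot>\<^sub>v v) = a * p v" if "0 \<le> a" "v \<in> carrier_vec k" for a v
    unfolding p_def sum_distrib_left using that insert.prems(1)
    by (intro sum.cong) (auto simp: abs_mult)
  \<comment> \<open>By homogeneity only \<open>v \<bullet> u \<in> {0, 1, -1}\<close> matters. The case \<open>1\<close> bounds \<open>s\<close> from below by the
    elements of \<open>A\<close>, the case \<open>-1\<close> from above; these bounds are compatible. The element \<open>- c i\<close>
    makes \<open>A\<close> nonempty and ensures that \<open>- c i \<le> s\<close>.\<close>
  define A where "A = insert (- c i) {v \<bullet> y - p v | v. v \<in> carrier_vec k \<and> v \<bullet> u = 1}"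
  define s where "s = Sup A"
  have A_le: "a \<le> c i" if "a \<in> A" for a
    using that dom ci unfolding A_def by fastforce
  then have bdd: "bdd_above A" by (auto simp: bdd_above_def)
  have s_le: "s \<le> c i" unfolding s_def using A_le by (intro cSup_least) (auto simp: A_def)
  have s_ge: "a \<le> s" if "a \<in> A" for a unfolding s_def using that bdd by (rule cSup_upper)
  have s_abs: "\<bar>s\<bar> \<le> c i" using s_le s_ge[of "- c i"] unfolding A_def by auto
  define z where "z = y - s \<cdot>\<^sub>v u"
  have z: "z \<in> carrier_vec k" unfolding z_def using y u by simp
  have vz: "v \<bullet> z = v \<bullet> y - s * (v \<bullet> u)" if v: "v \<in> carrier_vec k" for v
    unfolding z_def using v y u by (subst scalar_prod_minus_distrib[of _ k]) auto
  have z_dom: "v \<bullet> z \<le> p v" if v: "v \<in> carrier_vec k" for v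
  proof -
    consider "v \<bullet> u = 0" | "v \<bullet> u > 0" | "v \<bullet> u < 0" by linarith
    then show ?thesis
    proof cases
      case 1
      then show ?thesis using dom[OF v] vz[OF v] by simp
    next
      case 2
      define a where "a = v \<bullet> u"
      define w where "w = inverse a \<cdot>\<^sub>v v"
      have a: "a > 0" using 2 unfolding a_def .
      have w: "w \<in> carrier_vec k" unfolding w_def using v by simp
      have "w \<bullet> u = 1" unfolding w_def using v u a by (simp add: a_def)
      then have "w \<bullet> y - p w \<le> s" using w by (intro s_ge) (auto simp: A_def)
      moreover have "w \<bullet> y = inverse a * (v \<bullet> y)" "p w = inverse a * p v"
        unfolding w_def using v y a p_scale by auto
      ultimately have "v \<bullet> y - p v \<le> s * a" using a by (simp add: field_simps)
      then show ?thesis using vz[OF v] unfolding a_def by simp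
    next
      case 3
      define a where "a = - (v \<bullet> u)"
      define w where "w = inverse a \<cdot>\<^sub>v v"
      have a: "a > 0" using 3 unfolding a_def by simp
      have w: "w \<in> carrier_vec k" unfolding w_def using v by simp
      have "w \<bullet> u = inverse a * (- a)" unfolding w_def using v u by (simp add: a_def)
      then have wu: "w \<bullet> u = - 1" using a by simp
      have "s \<le> p w - w \<bullet> y" unfolding s_def
      proof (rule cSup_least)
        fix q assume "q \<in> A"
        then consider "q = - c i" | w' where "w' \<in> carrier_vec k" "w' \<bullet> u = 1" "q = w' \<bullet> y - p w'"
          unfolding A_def by auto
        then show "q \<le> p w - w \<bullet> y"
        proof cases
          case 1
          then show ?thesis using dom[OF w] wu by simp
        next
          case 2
          have "(w' + w) \<bullet> u = 0" using add_scalar_prod_distrib[OF 2(1) w u] 2(2) wu by simp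
          then have "(w' + w) \<bullet> y \<le> p (w' + w)" using dom[of "w' + w"] 2(1) w by simp
          then show ?thesis
            using p_add[OF 2(1) w] add_scalar_prod_distrib[OF 2(1) w y] 2(3) by simp
        qed
      qed (simp add: A_def)
      moreover have "w \<bullet> y = inverse a * (v \<bullet> y)" "p w = inverse a * p v"
        unfolding w_def using v y a p_scale by auto
      ultimately have "s * a \<le> p v - v \<bullet> y" using a by (simp add: field_simps)
      then show ?thesis using vz[OF v] unfolding a_def by simp
    qed
  qed
  obtain b where b: "\<forall>j\<in>S. \<bar>b j\<bar> \<le> c j" "\<forall>v\<in>carrier_vec k. v \<bullet> z = (\<Sum>j\<in>S. b j * (v \<bullet> x j))"
    using insert.IH[of z] insert.prems(1,3) z z_dom unfolding p_def by auto
  define b' where "b' = b(i := s)"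
  have b'S: "b' j = b j" if "j \<in> S" for j using that insert.hyps unfolding b'_def by auto
  have "v \<bullet> y = (\<Sum>j\<in>insert i S. b' j * (v \<bullet> x j))" if v: "v \<in> carrier_vec k" for v
  proof -
    have "(\<Sum>j\<in>S. b' j * (v \<bullet> x j)) = (\<Sum>j\<in>S. b j * (v \<bullet> x j))" using b'S by simp
    then have "(\<Sum>j\<in>insert i S. b' j * (v \<bullet> x j)) = s * (v \<bullet> u) + v \<bullet> z"
      using insert.hyps b(2) v unfolding u_def by (simp add: b'_def)
    then show ?thesis using vz[OF v] by simp
  qed
  moreover have "\<forall>j\<in>insert i S. \<bar>b' j\<bar> \<le> c j" using b(1) s_abs b'S unfolding b'_def by auto
  ultimately show ?case by blast
qed

section \<open>Lower bounds on the functional in terms of the row space\<close>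

lemma expectation_pmf_of_mset:
  fixes f :: "'a \<Rightarrow> real"
  assumes "xs \<noteq> []"
  shows "measure_pmf.expectation (pmf_of_multiset (mset xs)) f
    = (\<Sum>j<length xs. f (xs ! j)) / real (length xs)"
proof -
  have ne: "mset xs \<noteq> {#}" using assms by simp
  have "measure_pmf.expectation (pmf_of_multiset (mset xs)) f
      = (\<Sum>a\<in>set xs. pmf (pmf_of_multiset (mset xs)) a *\<^sub>R f a)"
    using ne by (intro integral_measure_pmf) auto
  also have "\<dots> = (\<Sum>a\<in>set xs. real (count_list xs a) * f a) / real (length xs)"
    using ne by (simp add: count_mset sum_divide_distrib)
  also have "(\<Sum>a\<in>set xs. real (count_list xs a) * f a)
      = (\<Sum>a\<in>set xs. \<Sum>j | j \<in> {..<length xs} \<and> xs ! j = a. f (xs ! j))"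
  proof (rule sum.cong)
    fix a
    have "count_list xs a = card {j. j \<in> {..<length xs} \<and> xs ! j = a}"
      unfolding count_list_eq_length_filter length_filter_conv_card by (rule arg_cong[of _ _ card]) auto
    moreover have "(\<Sum>j | j \<in> {..<length xs} \<and> xs ! j = a. f (xs ! j))
        = (\<Sum>j | j \<in> {..<length xs} \<and> xs ! j = a. f a)"
      by (intro sum.cong) auto
    ultimately show "real (count_list xs a) * f a
        = (\<Sum>j | j \<in> {..<length xs} \<and> xs ! j = a. f (xs ! j))"
      by simp
  qed simp
  also have "\<dots> = (\<Sum>j<length xs. f (xs ! j))"
    by (rule sum.group) auto
  finally show ?thesis .
qed

text \<open>
  The lower bound \<open>(1 + t) / n\<close> on the functional says that in every vector \<open>(v \<bullet> xs ! j)\<^sub>j\<close> of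
  the row space, \<open>t\<close> times the absolute value of an entry is at most the sum of the absolute values
  of the others. The excluded pairs with \<open>v \<bullet> xs ! i = 0\<close> satisfy this trivially.
\<close>

lemma le_L_iff:
  fixes xs :: "real Matrix.vec list"
  assumes n: "length xs = n" "n > 0" and xs: "set xs \<subseteq> carrier_vec k"
  shows "ereal ((1 + t) / real n) \<le> L k (pmf_of_multiset (mset xs)) \<longleftrightarrow>
    (\<forall>i<n. \<forall>v\<in>carrier_vec k. t * \<bar>v \<bullet> xs ! i\<bar> \<le> (\<Sum>j\<in>{..<n} - {i}. \<bar>v \<bullet> xs ! j\<bar>))"
proof -
  have ne: "xs \<noteq> []" using n by auto
  have E: "measure_pmf.expectation (pmf_of_multiset (mset xs)) (\<lambda>x. \<bar>v \<bullet> x\<bar>)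
      = (\<bar>v \<bullet> xs ! i\<bar> + (\<Sum>j\<in>{..<n} - {i}. \<bar>v \<bullet> xs ! j\<bar>)) / real n"
    if "i < n" for i and v :: "real Matrix.vec"
    using expectation_pmf_of_mset[OF ne] n that by (simp add: sum.remove[of _ i])
  have S: "set_pmf (pmf_of_multiset (mset xs)) = set xs" using ne by simp
  have R: "ereal ((1 + t) / real n) \<le> ratio (pmf_of_multiset (mset xs)) (xs ! i) v \<longleftrightarrow>
      t * \<bar>v \<bullet> xs ! i\<bar> \<le> (\<Sum>j\<in>{..<n} - {i}. \<bar>v \<bullet> xs ! j\<bar>)"
    if i: "i < n" for i and v :: "real Matrix.vec"
  proof (cases "v \<bullet> xs ! i = 0")
    case True
    then show ?thesis by (simp add: ratio_def sum_nonneg)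
  next
    case False
    then have "\<bar>v \<bullet> xs ! i\<bar> > 0" by simp
    then show ?thesis using False n(2) unfolding ratio_def E[OF i] by (simp add: field_simps)
  qed
  show ?thesis
  proof
    assume le: "ereal ((1 + t) / real n) \<le> L k (pmf_of_multiset (mset xs))"
    show "\<forall>i<n. \<forall>v\<in>carrier_vec k. t * \<bar>v \<bullet> xs ! i\<bar> \<le> (\<Sum>j\<in>{..<n} - {i}. \<bar>v \<bullet> xs ! j\<bar>)"
    proof (intro allI impI ballI)
      fix i and v :: "real Matrix.vec" assume i: "i < n" and v: "v \<in> carrier_vec k"
      have xi: "xs ! i \<in> set xs" "xs ! i \<in> carrier_vec k" using i n xs by auto
      show "t * \<bar>v \<bullet> xs ! i\<bar> \<le> (\<Sum>j\<in>{..<n} - {i}. \<bar>v \<bullet> xs ! j\<bar>)"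
      proof (cases "v \<bullet> xs ! i = 0")
        case True
        then show ?thesis by (simp add: sum_nonneg)
      next
        case False
        then have "xs ! i \<noteq> 0\<^sub>v k" "v \<noteq> 0\<^sub>v k" using v xi by auto
        then have "ereal ((1 + t) / real n) \<le> ratio (pmf_of_multiset (mset xs)) (xs ! i) v"
          using le xi(1) v unfolding L_def S by (simp add: le_INF_iff)
        then show ?thesis using R[OF i] by blast
      qed
    qed
  next
    assume all: "\<forall>i<n. \<forall>v\<in>carrier_vec k. t * \<bar>v \<bullet> xs ! i\<bar> \<le> (\<Sum>j\<in>{..<n} - {i}. \<bar>v \<bullet> xs ! j\<bar>)"
    show "ereal ((1 + t) / real n) \<le> L k (pmf_of_multiset (mset xs))"
      unfolding L_def S
    proof (intro INF_greatest)
      fix y v :: "real Matrix.vec" assume "y \<in> set xs - {0\<^sub>v k}" and v: "v \<in> carrier_vec k - {0\<^sub>v k}"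
      then obtain i where i: "i < n" "y = xs ! i" using n by (auto simp: in_set_conv_nth)
      then show "ereal ((1 + t) / real n) \<le> ratio (pmf_of_multiset (mset xs)) y v"
        using all R[OF i(1)] v by auto
    qed
  qed
qed

section \<open>From matrices to distributions and back\<close>

text \<open>
  The distribution is uniform over the columns of a left annihilator \<open>A\<close> of the matrix \<open>B\<close>.
\<close>

lemma off_feasible_imp_le_L:
  assumes feas: "off_feasible n d \<epsilon>" and dn: "d < n"
  shows "\<epsilon> > 0" and "\<exists>\<mu>\<in>P n (n - d). ereal ((1 + 1 / \<epsilon>) / real n) \<le> L (n - d) \<mu>"
proof -
  define k where "k = n - d"
  have k: "k > 0" using dn unfolding k_def by simp
  obtain B :: "real mat" where B: "B \<in> carrier_mat n n" "vec_space.rank n B \<le> d"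
      "\<And>i. i < n \<Longrightarrow> B $$ (i, i) = 1" "\<And>i j. i < n \<Longrightarrow> j < n \<Longrightarrow> i \<noteq> j \<Longrightarrow> \<bar>B $$ (i, j)\<bar> \<le> \<epsilon>"
    and e0: "\<epsilon> \<ge> 0"
    using feas unfolding off_feasible_def by blast
  have "k + vec_space.rank n B \<le> n" using B(2) dn unfolding k_def by simp
  from left_kernel_mat[OF B(1) this] obtain A where A: "A \<in> carrier_mat k n"
      "trivial_kernel (transpose_mat A)" "A * B = 0\<^sub>m k n" by blast
  have T: "transpose_mat A \<in> carrier_mat n k" using A by simp
  have nth: "cols A ! i = col A i" if "i < n" for i using that A by simp
  have key: "\<bar>v \<bullet> col A i\<bar> \<le> \<epsilon> * (\<Sum>j\<in>{..<n} - {i}. \<bar>v \<bullet> col A j\<bar>)"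
    if i: "i < n" and v: "v \<in> carrier_vec k" for i v
  proof -
    have cB: "col B i \<in> carrier_vec n" using B i by auto
    have "A *\<^sub>v col B i = 0\<^sub>v k"
    proof (rule eq_vecI)
      fix l assume "l < dim_vec (0\<^sub>v k :: real Matrix.vec)"
      then show "(A *\<^sub>v col B i) $ l = 0\<^sub>v k $ l"
        using arg_cong[OF A(3), of "\<lambda>M. M $$ (l, i)"] A(1) B(1) i by simp
    qed (use A in auto)
    then have "0 = (transpose_mat A *\<^sub>v v) \<bullet> col B i"
      using transpose_vec_mult_scalar[OF A(1) cB v] v by simp
    also have "\<dots> = (\<Sum>j<n. (v \<bullet> col A j) * B $$ (j, i))"
      using A(1) B(1) i v unfolding scalar_prod_def[of _ "col B i"]
      by (auto simp: atLeast0LessThan comm_scalar_prod[of v k] intro!: sum.cong)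
    also have "\<dots> = v \<bullet> col A i + (\<Sum>j\<in>{..<n} - {i}. (v \<bullet> col A j) * B $$ (j, i))"
      using i B(3) by (simp add: sum.remove[of _ i])
    finally have "\<bar>v \<bullet> col A i\<bar> = \<bar>\<Sum>j\<in>{..<n} - {i}. (v \<bullet> col A j) * B $$ (j, i)\<bar>" by linarith
    also have "\<dots> \<le> (\<Sum>j\<in>{..<n} - {i}. \<bar>v \<bullet> col A j\<bar> * \<epsilon>)"
      using B(4) i by (intro order_trans[OF sum_abs] sum_mono) (auto simp: abs_mult intro!: mult_left_mono)
    finally show ?thesis by (simp add: sum_distrib_left mult.commute)
  qed
  \<comment> \<open>For \<open>\<epsilon> = 0\<close> the bound \<open>key\<close> would force \<open>transpose_mat A\<close> to vanish.\<close>
  show e: "\<epsilon> > 0"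
  proof (rule ccontr)
    assume "\<not> \<epsilon> > 0"
    then have "\<epsilon> = 0" using e0 by simp
    let ?v = "unit_vec k 0 :: real Matrix.vec"
    have "transpose_mat A *\<^sub>v ?v = 0\<^sub>v n"
    proof (rule eq_vecI)
      fix i assume "i < dim_vec (0\<^sub>v n :: real Matrix.vec)"
      then have i: "i < n" by simp
      have "?v \<bullet> col A i = 0" using key[OF i, of ?v] \<open>\<epsilon> = 0\<close> by simp
      then show "(transpose_mat A *\<^sub>v ?v) $ i = 0\<^sub>v n $ i"
        using i A(1) comm_scalar_prod[of ?v k "col A i"] by simp
    qed (use A in auto)
    then have "?v = 0\<^sub>v k" using trivial_kernelD[OF A(2) T] by simp
    then show False using k unit_vec_nonzero[of k 0] by simp
  qed
  let ?\<mu> = "pmf_of_multiset (mset (cols A))"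
  have "?\<mu> \<in> P n k"
    unfolding P_def using A(1) cols_dim[of A] span_cols_eq_carrier_iff[OF A(1)] A(2)
    by (intro CollectI exI[of _ "mset (cols A)"]) auto
  moreover have "ereal ((1 + 1 / \<epsilon>) / real n) \<le> L k ?\<mu>"
    using A(1) cols_dim[of A] dn key e nth
    by (subst le_L_iff) (auto simp: field_simps)
  ultimately show "\<exists>\<mu>\<in>P n (n - d). ereal ((1 + 1 / \<epsilon>) / real n) \<le> L (n - d) \<mu>"
    unfolding k_def by blast
qed

text \<open>
  Conversely, column \<open>i\<close> of \<open>B\<close> records a relation that expresses \<open>xs ! i\<close> through the other
  vectors with coefficients of absolute value at most \<open>1 / t\<close>.
\<close>

lemma le_L_imp_off_feasible:
  assumes \<mu>: "\<mu> \<in> P n (n - d)" and dn: "d < n" and t: "t > 0"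
    and le: "ereal ((1 + t) / real n) \<le> L (n - d) \<mu>"
  shows "off_feasible n d (1 / t)"
proof -
  define k where "k = n - d"
  obtain X where X: "size X = n" "set_mset X \<subseteq> carrier_vec k"
      "LinearCombinations.module.span class_ring (module_vec TYPE(real) k) (set_mset X) = carrier_vec k"
      "\<mu> = pmf_of_multiset X"
    using \<mu> unfolding P_def k_def by blast
  obtain xs where xs: "mset xs = X" using ex_mset by blast
  have len: "length xs = n" and sub: "set xs \<subseteq> carrier_vec k" using X xs by auto
  have xc: "xs ! j \<in> carrier_vec k" if "j < n" for j using that len sub by auto
  let ?A = "mat_of_cols k xs"
  have A: "?A \<in> carrier_mat k n" using len by auto
  have cols: "cols ?A = xs" using sub by (simp add: subset_iff)
  have tk: "trivial_kernel (transpose_mat ?A)"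
    using span_cols_eq_carrier_iff[OF A] X(3) set_mset_mset[of xs] unfolding cols xs by simp
  have bal: "t * \<bar>v \<bullet> xs ! i\<bar> \<le> (\<Sum>j\<in>{..<n} - {i}. \<bar>v \<bullet> xs ! j\<bar>)"
    if "i < n" "v \<in> carrier_vec k" for i v
  proof -
    have "ereal ((1 + t) / real n) \<le> L k (pmf_of_multiset (mset xs))"
      using le X(4) xs unfolding k_def by simp
    moreover have "n > 0" using dn by simp
    ultimately show ?thesis using le_L_iff[OF len _ sub] that by blast
  qed
  have "\<exists>b. (\<forall>j\<in>{..<n} - {i}. \<bar>b j\<bar> \<le> 1 / t) \<and>
      (\<forall>v\<in>carrier_vec k. v \<bullet> xs ! i = (\<Sum>j\<in>{..<n} - {i}. b j * (v \<bullet> xs ! j)))" if i: "i < n" for i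
  proof (rule zonotope_membership)
    fix v :: "real Matrix.vec" assume v: "v \<in> carrier_vec k"
    have "v \<bullet> xs ! i \<le> \<bar>v \<bullet> xs ! i\<bar>" by simp
    also have "\<dots> \<le> (\<Sum>j\<in>{..<n} - {i}. \<bar>v \<bullet> xs ! j\<bar>) / t"
      using bal[OF i v] t by (simp add: field_simps)
    finally show "v \<bullet> xs ! i \<le> (\<Sum>j\<in>{..<n} - {i}. 1 / t * \<bar>v \<bullet> xs ! j\<bar>)"
      by (simp add: sum_divide_distrib)
  qed (use xc i t in auto)
  then obtain b where b0: "\<forall>i<n. (\<forall>j\<in>{..<n} - {i}. \<bar>b i j\<bar> \<le> 1 / t) \<and>
      (\<forall>v\<in>carrier_vec k. v \<bullet> xs ! i = (\<Sum>j\<in>{..<n} - {i}. b i j * (v \<bullet> xs ! j)))"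
    using choice[of "\<lambda>i b. i < n \<longrightarrow> (\<forall>j\<in>{..<n} - {i}. \<bar>b j\<bar> \<le> 1 / t) \<and>
      (\<forall>v\<in>carrier_vec k. v \<bullet> xs ! i = (\<Sum>j\<in>{..<n} - {i}. b j * (v \<bullet> xs ! j)))"] by blast
  have b: "\<bar>b i j\<bar> \<le> 1 / t" if "i < n" "j < n" "j \<noteq> i" for i j
    using b0 that by blast
  have bv: "v \<bullet> xs ! i = (\<Sum>j\<in>{..<n} - {i}. b i j * (v \<bullet> xs ! j))"
    if "i < n" "v \<in> carrier_vec k" for i v
    using b0 that by blast
  let ?B = "mat n n (\<lambda>(j, i). if j = i then 1 else - b i j)"
  have B: "?B \<in> carrier_mat n n" by simp
  have "?A * ?B = 0\<^sub>m k n"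
  proof (rule eq_matI)
    fix l i assume "l < dim_row (0\<^sub>m k n :: real mat)" "i < dim_col (0\<^sub>m k n :: real mat)"
    then have l: "l < k" and i: "i < n" by auto
    let ?v = "unit_vec k l :: real Matrix.vec"
    have ent: "?A $$ (l, j) = ?v \<bullet> xs ! j" if "j < n" for j
      using that l xc[OF that] len by (simp add: mat_of_cols_index)
    have "(?A * ?B) $$ (l, i) = (\<Sum>j<n. ?A $$ (l, j) * ?B $$ (j, i))"
      using l i len by (simp add: scalar_prod_def atLeast0LessThan)
    also have "\<dots> = (\<Sum>j<n. (?v \<bullet> xs ! j) * ?B $$ (j, i))" using ent by simp
    also have "\<dots> = ?v \<bullet> xs ! i + (\<Sum>j\<in>{..<n} - {i}. - (b i j * (?v \<bullet> xs ! j)))"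
      using i by (subst sum.remove[of _ i]) (auto intro!: sum.cong)
    also have "\<dots> = 0" using bv[OF i, of ?v] by (simp add: sum_negf)
    finally show "(?A * ?B) $$ (l, i) = 0\<^sub>m k n $$ (l, i)" using l i by simp
  qed (use len in auto)
  from rank_le_if_left_kernel_mat[OF A tk B this]
  have "vec_space.rank n ?B \<le> d" using dn unfolding k_def by simp
  then show ?thesis
    unfolding off_feasible_def using B b t by (intro conjI exI[of _ ?B]) auto
qed

lemma off_feasible_one:
  assumes "1 \<le> d"
  shows "off_feasible n d 1"
proof -
  let ?J = "mat n n (\<lambda>_. 1 :: real)"
  have "vec_space.rank n ?J \<le> 1"
    by (rule vec_space.rank_le_1_product_entries[of _ _ _ "\<lambda>_. 1" "\<lambda>_. 1"]) auto
  then show ?thesis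
    unfolding off_feasible_def using assms by (intro conjI exI[of _ ?J]) auto
qed

theorem theorem4:
  fixes n d :: nat
  assumes "1 \<le> d" and "d < n"
  shows "ereal (off n d) = 1 / (ereal (real n) * SL n (n - d) - 1)"
proof -
  note att = off_attained[OF off_feasible_one[OF assms(1), of n]]
  define e where "e = off n d"
  have e: "e > 0" and ex: "\<exists>\<mu>\<in>P n (n - d). ereal ((1 + 1 / e) / real n) \<le> L (n - d) \<mu>"
    using off_feasible_imp_le_L[OF att(1) assms(2)] unfolding e_def by auto
  have "SL n (n - d) = ereal ((1 + 1 / e) / real n)"
  proof (rule antisym)
    show "ereal ((1 + 1 / e) / real n) \<le> SL n (n - d)"
      using ex unfolding SL_def by (meson SUP_upper order_trans)
    show "SL n (n - d) \<le> ereal ((1 + 1 / e) / real n)"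
      unfolding SL_def
    proof (rule SUP_least, rule ccontr)
      fix \<mu> assume \<mu>: "\<mu> \<in> P n (n - d)" and "\<not> L (n - d) \<mu> \<le> ereal ((1 + 1 / e) / real n)"
      then obtain z where z: "ereal ((1 + 1 / e) / real n) < ereal z" "ereal z < L (n - d) \<mu>"
        using ereal_dense2 not_le by metis
      \<comment> \<open>Then \<open>z = (1 + t) / n\<close> with \<open>t > 1 / e\<close>, so \<open>1 / t < e\<close> would be feasible.\<close>
      define t where "t = real n * z - 1"
      have n0: "real n > 0" using assms by simp
      have te: "1 / e < t" using z(1) n0 unfolding t_def by (simp add: field_simps)
      have "1 / e > 0" using e by simp
      then have t0: "t > 0" using te by linarith
      have "(1 + t) / real n = z" using n0 unfolding t_def by simp
      then have "off_feasible n d (1 / t)"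
        using le_L_imp_off_feasible[OF \<mu> assms(2) t0] z(2) by simp
      then have "e \<le> 1 / t" using att(2) unfolding e_def by blast
      then show False using te e t0 by (simp add: field_simps)
    qed
  qed
  then have "ereal (real n) * SL n (n - d) - 1 = ereal (1 / e)"
    using assms by (simp add: one_ereal_def)
  then show ?thesis using e unfolding e_def by (simp add: one_ereal_def)
qed

end
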